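(* Let $n$ and $k$ be integers with $2\le k< n/2$, and let $GP(n,k)$ denote the generalized Petersen graph. (i) If $k\ge 3$ and $n>k(k+2)$, then $GP(n,k)$ is not distance-balanced. In addition, $GP(k(k+2),k)$ is distance-balanced. (ii) If $k=2$ and $n>10$, then $GP(n,2)$ is not distance-balanced. In addition, $GP(10,2)$ is distance-balanced.
   Context: For a connected graph $G$ and $x,y\in V(G)$, $d_G(x,y)$ is the length of a shortest $x,y$-path, and $W_{xy}=\{w\in V(G): d_G(w,x)<d_G(w,y)\}$. A connected graph $G$ of diameter at least $\ell$ is $\ell$-distance-balanced if $|W_{xy}|=|W_{yx}|$ for all $x,y\in V(G)$ with $d_G(x,y)=\ell$; distance-balanced means $1$-distance-balanced. For $n\ge 3$ and $1\le k<n/2$, the generalized Petersen graph $GP(n,k)$ has vertex set $\{u_i: i\in\mathbb{Z}_n\}\cup\{v_i: i\in\mathbb{Z}_n\}$ and edge set $\{u_iu_{i+1}: i\in\mathbb{Z}_n\}\cup\{v_iv_{i+k}: i\in\mathbb{Z}_n\}\cup\{u_iv_i: i\in\mathbb{Z}_n\}$. *)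

theory Defs
  imports "Graph_Theory.Graph_Theory"
begin

text \<open>
  Simple graphs are the symmetric loop-free digraphs of Graph_Theory (locale graph), an
  undirected edge being a pair of opposite arcs.  Distances are extended reals, as in
  Shortest_Path: they are infinite between different components.
\<close>

definition gdist :: "('a, 'b) pre_digraph \<Rightarrow> 'a \<Rightarrow> 'a \<Rightarrow> ereal" where
  "gdist G x y = wf_digraph.\<mu> G (\<lambda>_. 1) x y"

definition graph_diameter :: "('a, 'b) pre_digraph \<Rightarrow> ereal" where
  "graph_diameter G = (SUP x\<in>verts G. SUP y\<in>verts G. gdist G x y)"

definition closer :: "('a, 'b) pre_digraph \<Rightarrow> 'a \<Rightarrow> 'a \<Rightarrow> 'a set" where
  "closer G x y = {w \<in> verts G. gdist G w x < gdist G w y}"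

text \<open>Meant for finite graphs only, because of the cardinalities.\<close>

definition l_distance_balanced :: "nat \<Rightarrow> ('a, 'b) pre_digraph \<Rightarrow> bool" where
  "l_distance_balanced l G \<longleftrightarrow>
     Digraph_Component.connected G \<and> ereal (real l) \<le> graph_diameter G \<and>
     (\<forall>x\<in>verts G. \<forall>y\<in>verts G.
        gdist G x y = ereal (real l) \<longrightarrow> card (closer G x y) = card (closer G y x))"

abbreviation distance_balanced :: "('a, 'b) pre_digraph \<Rightarrow> bool" where
  "distance_balanced \<equiv> l_distance_balanced 1"

text \<open>The index set of the integers modulo n is represented by the residues 0, ..., n - 1.\<close>

datatype gp_vertex = U nat | V nat

definition GP_edges :: "nat \<Rightarrow> nat \<Rightarrow> (gp_vertex \<times> gp_vertex) set" where
  "GP_edges n k = {(U i, U ((i + 1) mod n)) | i. i < n}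
     \<union> {(V i, V ((i + k) mod n)) | i. i < n}
     \<union> {(U i, V i) | i. i < n}"

definition GP :: "nat \<Rightarrow> nat \<Rightarrow> gp_vertex pair_pre_digraph" where
  "GP n k = \<lparr> pverts = U ` {..<n} \<union> V ` {..<n}, parcs = GP_edges n k \<union> (GP_edges n k)\<inverse> \<rparr>"

text \<open>The distance is the length of a shortest path.\<close>

lemma (in wf_digraph) awalk_cost_unit: "awalk_cost (\<lambda>_. 1) p = real (length p)"
  by (induction p) auto

lemma (in fin_digraph) gdist_eq_shortest_path_length:
  assumes "x \<rightarrow>\<^sup>*\<^bsub>G\<^esub> y"
  shows "\<exists>p. apath x p y \<and> gdist G x y = ereal (real (length p))
           \<and> (\<forall>q. apath x q y \<longrightarrow> length p \<le> length q)"
proof -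
  obtain p where p: "apath x p y" "\<mu> (\<lambda>_. 1) x y = awalk_cost (\<lambda>_. 1) p"
    using min_cost_awalk[OF assms, of "\<lambda>_. 1"] by auto
  have "length p \<le> length q" if "apath x q y" for q
    using min_cost_le_walk_cost[of x q y "\<lambda>_. 1"] that p(2)
    by (auto simp: apath_def awalk_cost_unit)
  then show ?thesis
    using p by (auto simp: gdist_def awalk_cost_unit)
qed

lemma pair_graph_GP:
  assumes "1 \<le> k" "2 * k < n"
  shows "pair_graph (GP n k)"
proof -
  have *: "(i + d) mod n \<noteq> i" if "0 < d" "d < n" "i < n" for i d
  proof (cases "i + d < n")
    case False
    then have "(i + d) mod n = i + d - n"
      using that by (simp add: mod_if)
    then show ?thesis using that False by linarith
  qed (use that in auto)
  have fin: "finite (GP_edges n k)"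
    by (simp add: GP_edges_def)
  show ?thesis
  proof unfold_locales
    show "fst e \<in> pverts (GP n k)" "snd e \<in> pverts (GP n k)" if "e \<in> parcs (GP n k)" for e
      using that assms by (auto simp: GP_def GP_edges_def)
    show "finite (pverts (GP n k))" "finite (parcs (GP n k))"
      using fin by (auto simp: GP_def)
    show "fst e \<noteq> snd e" if "e \<in> parcs (GP n k)" for e
      using that assms *[of 1] *[of k] by (auto simp: GP_def GP_edges_def) metis+
    show "symmetric (with_proj (GP n k))"
      by (auto simp: symmetric_def GP_def intro!: symI)
  qed
qed

lemma connected_GP:
  assumes "1 \<le> k" "2 * k < n"
  shows "Digraph_Component.connected (GP n k)"
proof -
  interpret pair_graph "GP n k" by (rule pair_graph_GP[OF assms])
  have U: "U 0 \<rightarrow>\<^sup>*\<^bsub>GP n k\<^esub> U i" if "i < n" for i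
    using that
  proof (induction i)
    case 0
    then have "U 0 \<in> pverts (GP n k)" by (auto simp: GP_def)
    then show ?case by (rule reachable_refl)
  next
    case (Suc i)
    have "(U i, U (Suc i)) \<in> GP_edges n k"
      using Suc.prems unfolding GP_edges_def by (auto intro!: exI[of _ i])
    then have "(U i, U (Suc i)) \<in> parcs (GP n k)"
      by (simp add: GP_def)
    with Suc show ?case
      by (metis Suc_lessD reachable_adj_trans)
  qed
  have V: "U 0 \<rightarrow>\<^sup>*\<^bsub>GP n k\<^esub> V i" if "i < n" for i
  proof -
    have "(U i, V i) \<in> parcs (GP n k)"
      using that by (auto simp: GP_def GP_edges_def)
    with U[OF that] show ?thesis
      by (rule reachable_adj_trans)
  qed
  have *: "U 0 \<rightarrow>\<^sup>*\<^bsub>GP n k\<^esub> x" if "x \<in> pverts (GP n k)" for x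
  proof (cases x)
    case (U i)
    with that have "i < n" by (auto simp: GP_def)
    with \<open>x = U i\<close> show ?thesis using \<open>\<And>i. i < n \<Longrightarrow> U 0 \<rightarrow>\<^sup>*\<^bsub>GP n k\<^esub> U i\<close> by simp
  next
    case (V i)
    with that have "i < n" by (auto simp: GP_def)
    with \<open>x = V i\<close> show ?thesis using \<open>\<And>i. i < n \<Longrightarrow> U 0 \<rightarrow>\<^sup>*\<^bsub>GP n k\<^esub> V i\<close> by simp
  qed
  have **: "a \<rightarrow>\<^sup>*\<^bsub>GP n k\<^esub> b" if "a \<in> pverts (GP n k)" "b \<in> pverts (GP n k)" for a b
    using symmetric_reachable'[OF *[OF that(1)]] *[OF that(2)] by (rule reachable_trans)
  have "pverts (GP n k) \<noteq> {}"
    using assms by (auto simp: GP_def)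
  then show ?thesis
    using ** by (auto intro!: connectedI reachable_mk_symmetricI)
qed

end

theory Submission
  imports Defs
begin

text \<open>
  Write \<open>f d\<close> for the word length of \<open>d\<close> in the integers modulo \<open>n\<close> with respect to the generators
  \<open>1\<close> and \<open>k\<close>. A shortest path between vertices of index difference \<open>d\<close> has length \<open>f d + 1\<close> if
  they lie on different rims; on the same rim it either stays there or has length \<open>f d + 2\<close>.
  The two ends of a rim edge are swapped by a reflection, so only the spokes matter. For
  \<open>s \<in> {1, k}\<close> let \<open>N s t\<close> be the number of residues \<open>d\<close> that are a sum of at most \<open>f d + t\<close>
  summands \<open>s\<close> or \<open>- s\<close>. Then a spoke is balanced iff \<open>N 1 0 + N 1 1 = N k 0 + N k 1\<close>.
  For \<open>k \<ge> 3\<close> the left-hand side is at most \<open>2 k + 4\<close>, since beyond \<open>k / 2 + 1\<close> steps of size 1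
  one step of size \<open>k\<close> saves at least two; here \<open>k = 2\<close> is exceptional, with the bound \<open>10\<close>.
  On the right-hand side both summands are at least \<open>q\<close> if \<open>k (q - 1) < n\<close>, and equal to \<open>q\<close> if
  \<open>n = k q\<close>.
\<close>

section \<open>Distances as lengths of walks\<close>

text \<open>Walk costs are natural numbers, so without a walk of length at most \<open>m\<close>
  every member of the infimum is at least \<open>m + 1\<close>.\<close>

lemma gdist_le_iff:
  assumes "pair_wf_digraph G"
  shows "gdist (with_proj G) x y \<le> ereal (real m) \<longleftrightarrow>
    (\<exists>p. pre_digraph.awalk (with_proj G) x p y \<and> length p \<le> m)"
proof -
  interpret pair_wf_digraph G by fact
  show ?thesis
  proof
    show "gdist (with_proj G) x y \<le> ereal (real m)" if "\<exists>p. awalk x p y \<and> length p \<le> m"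
      using that min_cost_le_walk_cost[of x _ y "\<lambda>_. 1"]
      by (force simp: gdist_def awalk_cost_unit intro: order_trans)
    show "\<exists>p. awalk x p y \<and> length p \<le> m" if "gdist (with_proj G) x y \<le> ereal (real m)"
    proof (rule ccontr)
      assume "\<nexists>p. awalk x p y \<and> length p \<le> m"
      then have "ereal (real (Suc m)) \<le> gdist (with_proj G) x y"
        unfolding gdist_def \<mu>_def
        by (intro INF_greatest) (auto simp: awalk_cost_unit not_le simp flip: of_nat_Suc)
      then have "ereal (real (Suc m)) \<le> ereal (real m)" using that by (rule order_trans)
      then show False by simp
    qed
  qed
qed

text \<open>Peeling off the first arc matches the recursion of relation powers. Membership of
  \<open>x\<close> matters for \<open>m = 0\<close>, since the empty walk exists only at a
  vertex.\<close>

lemma (in pair_wf_digraph) awalk_length_iff_relpow: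
  assumes "x \<in> pverts G"
  shows "(\<exists>p. awalk x p y \<and> length p = m) \<longleftrightarrow> (x, y) \<in> parcs G ^^ m"
  using assms
proof (induction m arbitrary: x)
  case 0
  then show ?case by (auto simp: awalk_def)
next
  case (Suc m)
  have "(\<exists>p. awalk x p y \<and> length p = Suc m) \<longleftrightarrow>
    (\<exists>z. (x, z) \<in> parcs G \<and> (\<exists>p. awalk z p y \<and> length p = m))"
  proof
    assume "\<exists>p. awalk x p y \<and> length p = Suc m"
    then obtain e p where "awalk x (e # p) y" "length p = m"
      by (auto simp: length_Suc_conv)
    then show "\<exists>z. (x, z) \<in> parcs G \<and> (\<exists>p. awalk z p y \<and> length p = m)"
      by (auto simp: awalk_Cons_iff intro!: exI[of _ "snd e"])
  next
    assume "\<exists>z. (x, z) \<in> parcs G \<and> (\<exists>p. awalk z p y \<and> length p = m)"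
    then obtain z p where "(x, z) \<in> parcs G" "awalk z p y" "length p = m" by blast
    then show "\<exists>p. awalk x p y \<and> length p = Suc m"
      by (intro exI[of _ "(x, z) # p"]) (auto simp: awalk_Cons_iff)
  qed
  also have "\<dots> \<longleftrightarrow> (\<exists>z. (x, z) \<in> parcs G \<and> (z, y) \<in> parcs G ^^ m)"
    using Suc.IH in_arcsD2 by metis
  also have "\<dots> \<longleftrightarrow> (x, y) \<in> parcs G ^^ Suc m"
    by (meson relpow_Suc_I2 relpow_Suc_E2)
  finally show ?case .
qed

section \<open>Word length in the integers modulo n\<close>

text \<open>Describes walks staying on one rim: \<open>s = 1\<close> is the outer rim,
  \<open>s = k\<close> the inner one. Opposite steps cancel, so one signed total \<open>a\<close>
  suffices.\<close>

definition reach :: "nat \<Rightarrow> nat \<Rightarrow> int \<Rightarrow> nat \<Rightarrow> bool" where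
  "reach n s d m \<longleftrightarrow> (\<exists>a. \<bar>a\<bar> \<le> int m \<and> int n dvd a * int s - d)"

text \<open>This is \<open>f\<close> of the overview, the distance from 0 to \<open>d\<close> in the
  circulant graph with jumps 1 and \<open>k\<close>. Arbitrary integers \<open>d\<close> are
  allowed, so index differences need no reduction.\<close>

definition circ_norm :: "nat \<Rightarrow> nat \<Rightarrow> int \<Rightarrow> nat" where
  "circ_norm n k d = (LEAST m. \<exists>a c. \<bar>a\<bar> + \<bar>c\<bar> \<le> int m \<and> int n dvd a + c * int k - d)"

text \<open>The condition is upward closed in \<open>m\<close>, and walking \<open>d\<close> with
  steps of size 1 shows that it is satisfiable.\<close>

lemma circ_norm_le_iff:
  "circ_norm n k d \<le> m \<longleftrightarrow> (\<exists>a c. \<bar>a\<bar> + \<bar>c\<bar> \<le> int m \<and> int n dvd a + c * int k - d)"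
  (is "_ \<longleftrightarrow> ?P m")
proof
  have "?P (nat \<bar>d\<bar>)" by (rule exI[of _ d], rule exI[of _ 0]) simp
  then have "?P (circ_norm n k d)" unfolding circ_norm_def by (rule LeastI)
  then show "?P m" if "circ_norm n k d \<le> m"
    using that by (meson of_nat_mono order_trans)
  show "circ_norm n k d \<le> m" if "?P m"
    unfolding circ_norm_def using that by (rule Least_le)
qed

lemma circ_norm_le:
  assumes "\<bar>a\<bar> + \<bar>c\<bar> \<le> int m" "int n dvd a + c * int k - d"
  shows "circ_norm n k d \<le> m"
  using assms circ_norm_le_iff by blast

lemma obtain_circ_norm:
  obtains a c where "\<bar>a\<bar> + \<bar>c\<bar> \<le> int (circ_norm n k d)" "int n dvd a + c * int k - d"
  using circ_norm_le_iff[of n k d "circ_norm n k d"] by auto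

lemma reach_uminus [simp]: "reach n s (- d) m \<longleftrightarrow> reach n s d m"
proof -
  have "reach n s (- d) m" if "reach n s d m" for d
  proof -
    from that obtain a where a: "\<bar>a\<bar> \<le> int m" "int n dvd a * int s - d"
      by (auto simp: reach_def)
    from a(2) have "int n dvd - (a * int s - d)" by (simp only: dvd_minus_iff)
    with a(1) show ?thesis by (auto simp: reach_def intro!: exI[of _ "- a"])
  qed
  from this[of d] this[of "- d"] show ?thesis by auto
qed

lemma circ_norm_uminus [simp]: "circ_norm n k (- d) = circ_norm n k d"
proof -
  have "circ_norm n k (- d) \<le> circ_norm n k d" for d
  proof -
    obtain a c where ac: "\<bar>a\<bar> + \<bar>c\<bar> \<le> int (circ_norm n k d)" "int n dvd a + c * int k - d"
      by (rule obtain_circ_norm)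
    from ac(2) have "int n dvd - (a + c * int k - d)" by (simp only: dvd_minus_iff)
    then have "int n dvd (- a) + (- c) * int k - (- d)" by (simp add: algebra_simps)
    with ac(1) show ?thesis by (intro circ_norm_le[of "- a" "- c"]) auto
  qed
  from this[of d] this[of "- d"] show ?thesis by auto
qed

lemma reach_cong: "reach n s d m \<longleftrightarrow> reach n s d' m" if "int n dvd d - d'"
proof -
  have "int n dvd x - d \<longleftrightarrow> int n dvd x - d'" for x
    using that dvd_add_right_iff[of "int n" "d - d'" "x - d"] by simp
  then show ?thesis by (simp add: reach_def)
qed

lemma circ_norm_cong: "circ_norm n k d = circ_norm n k d'" if "int n dvd d - d'"
proof -
  have "int n dvd x - d \<longleftrightarrow> int n dvd x - d'" for x
    using that dvd_add_right_iff[of "int n" "d - d'" "x - d"] by simp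
  then show ?thesis by (simp add: circ_norm_def)
qed

lemma reach_mono: "reach n s d m \<Longrightarrow> m \<le> m' \<Longrightarrow> reach n s d m'"
  by (force simp: reach_def)

lemma reach_0: "int n dvd d \<Longrightarrow> reach n s d m"
  by (auto simp: reach_def intro!: exI[of _ 0])

lemma reach_step:
  assumes "reach n s d m" "int n dvd d' - d - int s \<or> int n dvd d' - d + int s"
  shows "reach n s d' (Suc m)"
proof -
  obtain a where a: "\<bar>a\<bar> \<le> int m" "int n dvd a * int s - d"
    using assms(1) by (auto simp: reach_def)
  from assms(2) obtain e :: int where e: "\<bar>e\<bar> = 1" "int n dvd d' - d - e * int s"
    by (metis abs_1 abs_minus_cancel diff_minus_eq_add mult_1 mult_minus_left)
  from dvd_diff[OF a(2) e(2)] have "int n dvd (a + e) * int s - d'"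
    by (simp add: algebra_simps)
  with a(1) e(1) show ?thesis by (auto simp: reach_def intro!: exI[of _ "a + e"])
qed

text \<open>The additional step is absorbed into \<open>a\<close> if \<open>s = 1\<close> and into
  \<open>c\<close> if \<open>s = k\<close>.\<close>

lemma circ_norm_step:
  assumes "s = 1 \<or> s = k" "int n dvd d' - d - int s \<or> int n dvd d' - d + int s"
  shows "circ_norm n k d' \<le> Suc (circ_norm n k d)"
proof -
  obtain a c where ac: "\<bar>a\<bar> + \<bar>c\<bar> \<le> int (circ_norm n k d)" "int n dvd a + c * int k - d"
    by (rule obtain_circ_norm)
  from assms(2) obtain e :: int where e: "\<bar>e\<bar> = 1" "int n dvd d' - d - e * int s"
    by (metis abs_1 abs_minus_cancel diff_minus_eq_add mult_1 mult_minus_left)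
  from assms(1) show ?thesis
  proof
    assume "s = 1"
    with dvd_diff[OF ac(2) e(2)] have "int n dvd (a + e) + c * int k - d'"
      by (simp add: algebra_simps)
    with ac(1) e(1) show ?thesis by (intro circ_norm_le) auto
  next
    assume "s = k"
    with dvd_diff[OF ac(2) e(2)] have "int n dvd a + (c + e) * int k - d'"
      by (simp add: algebra_simps)
    with ac(1) e(1) show ?thesis by (intro circ_norm_le) auto
  qed
qed

lemma circ_norm_le_reach: "reach n s d m \<Longrightarrow> s = 1 \<or> s = k \<Longrightarrow> circ_norm n k d \<le> m"
  by (auto simp: reach_def intro: circ_norm_le[of _ 0] circ_norm_le[of 0])

section \<open>Distances in generalized Petersen graphs\<close>

lemma eq_mod_iff_dvd:
  fixes i j s n :: nat
  assumes "j < n"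
  shows "j = (i + s) mod n \<longleftrightarrow> int n dvd int j - int i - int s"
proof -
  have "j = (i + s) mod n \<longleftrightarrow> int j mod int n = int (i + s) mod int n"
    using assms by (metis mod_less of_nat_eq_iff of_nat_mod)
  then show ?thesis by (simp add: mod_eq_dvd_iff algebra_simps)
qed

text \<open>\<open>near n k x y m\<close> expresses that the distance from \<open>x\<close> to \<open>y\<close> is at most \<open>m\<close>.\<close>

fun near :: "nat \<Rightarrow> nat \<Rightarrow> gp_vertex \<Rightarrow> gp_vertex \<Rightarrow> nat \<Rightarrow> bool" where
  "near n k (U i) (U j) m \<longleftrightarrow> reach n 1 (int j - int i) m \<or> circ_norm n k (int j - int i) + 2 \<le> m"
| "near n k (V i) (V j) m \<longleftrightarrow> reach n k (int j - int i) m \<or> circ_norm n k (int j - int i) + 2 \<le> m"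
| "near n k (U i) (V j) m \<longleftrightarrow> circ_norm n k (int j - int i) + 1 \<le> m"
| "near n k (V i) (U j) m \<longleftrightarrow> circ_norm n k (int j - int i) + 1 \<le> m"

locale generalized_petersen =
  fixes n k :: nat
  assumes k_pos: "1 \<le> k" and k_less: "2 * k < n"
begin

sublocale pair_graph "GP n k"
  by (rule pair_graph_GP[OF k_pos k_less])

lemma verts_GP: "pverts (GP n k) = U ` {..<n} \<union> V ` {..<n}"
  by (simp add: GP_def)

lemma arc_UU: "(U i, U j) \<in> parcs (GP n k) \<longleftrightarrow>
    i < n \<and> j < n \<and> (int n dvd int j - int i - 1 \<or> int n dvd int j - int i + 1)"
  using k_less eq_mod_iff_dvd[of j n i 1] eq_mod_iff_dvd[of i n j 1]
    dvd_minus_iff[of "int n" "int j - int i + 1"]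
  by (auto simp: GP_def GP_edges_def)

lemma arc_VV: "(V i, V j) \<in> parcs (GP n k) \<longleftrightarrow>
    i < n \<and> j < n \<and> (int n dvd int j - int i - int k \<or> int n dvd int j - int i + int k)"
  using k_less eq_mod_iff_dvd[of j n i k] eq_mod_iff_dvd[of i n j k]
    dvd_minus_iff[of "int n" "int j - int i + int k"]
  by (auto simp: GP_def GP_edges_def)

lemma arc_UV: "(U i, V j) \<in> parcs (GP n k) \<longleftrightarrow> i < n \<and> j = i"
  by (auto simp: GP_def GP_edges_def)

lemma arc_VU: "(V i, U j) \<in> parcs (GP n k) \<longleftrightarrow> i < n \<and> j = i"
  by (auto simp: GP_def GP_edges_def)

lemmas arc_iff = arc_UU arc_VV arc_UV arc_VU

lemma near_refl: "near n k x x m"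
  by (cases x) (auto intro: reach_0)

lemma near_mono: "near n k x y m \<Longrightarrow> m \<le> m' \<Longrightarrow> near n k x y m'"
  by (cases x; cases y) (auto intro: reach_mono)

text \<open>A rim arc shifts the index difference by one step of that rim. A spoke keeps the
  difference and costs 1; when a walk so far confined to its rim takes a spoke,
  \<open>circ_norm_le_reach\<close> gives the bound.\<close>

lemma near_step:
  assumes "near n k x y m" "(y, z) \<in> parcs (GP n k)"
  shows "near n k x z (Suc m)"
proof (cases y)
  case y: (U j)
  show ?thesis
  proof (cases z)
    case z: (U l)
    have *: "int n dvd (int l - int i) - (int j - int i) - int 1 \<or>
             int n dvd (int l - int i) - (int j - int i) + int 1" for i
      using assms(2) by (auto simp: y z arc_iff)
    note step = reach_step[OF _ *] circ_norm_step[OF _ *, of k]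
    show ?thesis
    proof (cases x)
      case x: (U i)
      show ?thesis using assms(1) step[of i] by (auto simp: x y z)
    next
      case x: (V i)
      show ?thesis using assms(1) step[of i] by (auto simp: x y z)
    qed
  next
    case z: (V l)
    then show ?thesis
      using assms circ_norm_le_reach by (cases x) (fastforce simp: y z arc_iff)+
  qed
next
  case y: (V j)
  show ?thesis
  proof (cases z)
    case z: (V l)
    have *: "int n dvd (int l - int i) - (int j - int i) - int k \<or>
             int n dvd (int l - int i) - (int j - int i) + int k" for i
      using assms(2) by (auto simp: y z arc_iff)
    note step = reach_step[OF _ *] circ_norm_step[OF _ *, of k]
    show ?thesis
    proof (cases x)
      case x: (U i)
      show ?thesis using assms(1) step[of i] by (auto simp: x y z)
    next
      case x: (V i)
      show ?thesis using assms(1) step[of i] by (auto simp: x y z)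
    qed
  next
    case z: (U l)
    then show ?thesis
      using assms circ_norm_le_reach by (cases x) (fastforce simp: y z arc_iff)+
  qed
qed

lemma relpow_imp_near: "(x, y) \<in> parcs (GP n k) ^^ m \<Longrightarrow> near n k x y m"
  by (induction m arbitrary: y) (auto intro: near_refl near_step)

definition residue :: "int \<Rightarrow> nat" where
  "residue d = nat (d mod int n)"

lemma residue_less [simp]: "residue d < n"
  using k_less by (simp add: residue_def nat_less_iff)

lemma dvd_residue_diff [simp]: "int n dvd int (residue d) - d"
  using k_less by (simp add: residue_def flip: mod_eq_dvd_iff)

lemma residue_eqI:
  assumes "j < n" "int n dvd int j - d"
  shows "residue d = j"
proof -
  have "d mod int n = int j mod int n"
    using assms(2) by (simp add: mod_eq_dvd_iff dvd_diff_commute)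
  with assms(1) show ?thesis by (simp add: residue_def)
qed

text \<open>Turns a signed number of rim steps into a walk. The constructor \<open>C\<close> is left
  open so that both rims share one induction.\<close>

lemma relpow_steps:
  assumes arc: "\<And>i j. i < n \<Longrightarrow> j < n \<Longrightarrow>
      int n dvd int j - int i - int s \<or> int n dvd int j - int i + int s \<Longrightarrow>
      (C i, C j) \<in> parcs (GP n k)"
    and "i < n" "j < n" "int n dvd a * int s - (int j - int i)"
  shows "(C i, C j) \<in> parcs (GP n k) ^^ nat \<bar>a\<bar>"
  using assms(2-)
proof (induction "nat \<bar>a\<bar>" arbitrary: a i)
  case 0
  then have "int n dvd int i - int j" "a = 0" by (simp_all)
  then have "i = j"
    using 0 residue_eqI[of i "int j"] residue_eqI[of j "int j"] by simp
  then show ?case using \<open>a = 0\<close> by simp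
next
  case (Suc m)
  \<comment> \<open>The first step goes in the direction of \<open>a\<close>, so that
    \<open>a - sgn a\<close> is one closer to 0.\<close>
  define l where "l = residue (int i + sgn a * int s)"
  have l: "l < n" "int n dvd int l - (int i + sgn a * int s)"
    by (simp_all only: l_def residue_less dvd_residue_diff)
  have "a \<noteq> 0" using Suc.hyps(2) by auto
  then have "m = nat \<bar>a - sgn a\<bar>" using Suc.hyps(2) by (auto simp: sgn_if)
  moreover have "int n dvd (a - sgn a) * int s - (int j - int l)"
    using dvd_add[OF Suc.prems(3) l(2)] by (simp add: algebra_simps)
  ultimately have "(C l, C j) \<in> parcs (GP n k) ^^ m"
    using Suc.hyps(1) l(1) Suc.prems by blast
  moreover have "(C i, C l) \<in> parcs (GP n k)"
    using l \<open>a \<noteq> 0\<close> Suc.prems(1) by (intro arc) (auto simp: sgn_if algebra_simps split: if_splits)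
  ultimately show ?case
    using Suc.hyps(2) by (metis relpow_Suc_I2)
qed

lemma relpow_UU:
  assumes "i < n" "j < n" "int n dvd a - (int j - int i)"
  shows "(U i, U j) \<in> parcs (GP n k) ^^ nat \<bar>a\<bar>"
  using relpow_steps[of 1 U i j a] assms by (simp add: arc_iff)

lemma relpow_VV:
  assumes "i < n" "j < n" "int n dvd a * int k - (int j - int i)"
  shows "(V i, V j) \<in> parcs (GP n k) ^^ nat \<bar>a\<bar>"
  using relpow_steps[of k V i j a] assms by (simp add: arc_iff)

text \<open>Steps commute, so a shortest word can be walked with its steps of size 1 on the outer
  rim and those of size \<open>k\<close> on the inner rim, joined by a single spoke. If both ends
  lie on one rim, a second spoke leads back.\<close>

lemma near_imp_relpow:
  assumes "x \<in> pverts (GP n k)" "y \<in> pverts (GP n k)" "near n k x y m"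
  shows "\<exists>l\<le>m. (x, y) \<in> parcs (GP n k) ^^ l"
proof -
  let ?R = "parcs (GP n k)"
  \<comment> \<open>The spoke is taken at \<open>r\<close> if the outer steps come first and at
    \<open>l\<close> if the inner ones do, according to the rim of the start.\<close>
  have through: "\<exists>r l p. r < n \<and> l < n \<and> p \<le> circ_norm n k (int j - int i) \<and>
      (\<exists>q1 q2. p = q1 + q2 \<and> (U i, U r) \<in> ?R ^^ q1 \<and> (V r, V j) \<in> ?R ^^ q2 \<and>
                (V i, V l) \<in> ?R ^^ q2 \<and> (U l, U j) \<in> ?R ^^ q1)" if "i < n" "j < n" for i j
  proof -
    obtain a c where ac: "\<bar>a\<bar> + \<bar>c\<bar> \<le> int (circ_norm n k (int j - int i))"
      "int n dvd a + c * int k - (int j - int i)"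
      by (rule obtain_circ_norm)
    let ?r = "residue (int i + a)" and ?l = "residue (int i + c * int k)"
    have 1: "int n dvd int ?r - (int i + a)" "int n dvd int ?l - (int i + c * int k)"
      by (rule dvd_residue_diff)+
    have "int n dvd a - (int ?r - int i)" "int n dvd c * int k - (int ?l - int i)"
      using 1 dvd_minus_iff[of "int n" "int ?r - (int i + a)"]
        dvd_minus_iff[of "int n" "int ?l - (int i + c * int k)"] by (simp_all add: algebra_simps)
    moreover have "int n dvd c * int k - (int j - int ?r)" "int n dvd a - (int j - int ?l)"
      using dvd_add[OF ac(2) 1(1)] dvd_add[OF ac(2) 1(2)] by (simp_all add: algebra_simps)
    ultimately have "(U i, U ?r) \<in> ?R ^^ nat \<bar>a\<bar>" "(V ?r, V j) \<in> ?R ^^ nat \<bar>c\<bar>"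
      "(V i, V ?l) \<in> ?R ^^ nat \<bar>c\<bar>" "(U ?l, U j) \<in> ?R ^^ nat \<bar>a\<bar>"
      using that by (intro relpow_UU relpow_VV; simp)+
    moreover have "nat \<bar>a\<bar> + nat \<bar>c\<bar> \<le> circ_norm n k (int j - int i)" using ac(1) by linarith
    ultimately show ?thesis using residue_less by blast
  qed
  have UV: "(U i, V j) \<in> ?R ^^ Suc p" if "(U i, U r) \<in> ?R ^^ q1" "(V r, V j) \<in> ?R ^^ q2"
    "p = q1 + q2" "r < n" for i j r q1 q2 p
  proof -
    have "(U i, V r) \<in> ?R ^^ Suc q1" using that arc_UV by (auto intro: relpow_Suc_I)
    with that show ?thesis using relpow_add[of "Suc q1" q2 ?R] by auto
  qed
  have VU: "(V i, U j) \<in> ?R ^^ Suc p" if "(V i, V l) \<in> ?R ^^ q2" "(U l, U j) \<in> ?R ^^ q1"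
    "p = q1 + q2" "l < n" for i j l q1 q2 p
  proof -
    have "(V i, U l) \<in> ?R ^^ Suc q2" using that arc_VU by (auto intro: relpow_Suc_I)
    with that show ?thesis using relpow_add[of "Suc q2" q1 ?R] by (auto simp: add.commute)
  qed
  have UV': "\<exists>l\<le>circ_norm n k (int j - int i) + 1. (U i, V j) \<in> ?R ^^ l"
    and VU': "\<exists>l\<le>circ_norm n k (int j - int i) + 1. (V i, U j) \<in> ?R ^^ l"
    if "i < n" "j < n" for i j
    using through[OF that] UV VU by (metis Suc_eq_plus1 Suc_le_mono)+
  show ?thesis
  proof (cases x; cases y)
    fix i j assume [simp]: "x = U i" "y = V j"
    show ?thesis using assms UV'[of i j] by (auto simp: verts_GP intro: order_trans)
  next
    fix i j assume [simp]: "x = V i" "y = U j"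
    show ?thesis using assms VU'[of i j] by (auto simp: verts_GP intro: order_trans)
  next
    fix i j assume xy [simp]: "x = U i" "y = U j"
    have ij: "i < n" "j < n" using assms by (auto simp: verts_GP)
    from assms(3) have "reach n 1 (int j - int i) m \<or> circ_norm n k (int j - int i) + 2 \<le> m"
      by simp
    then show ?thesis
    proof
      assume "reach n 1 (int j - int i) m"
      then obtain a where "\<bar>a\<bar> \<le> int m" "int n dvd a - (int j - int i)" by (auto simp: reach_def)
      with relpow_UU[of i j a] ij show ?thesis by (auto intro!: exI[of _ "nat \<bar>a\<bar>"])
    next
      assume m: "circ_norm n k (int j - int i) + 2 \<le> m"
      obtain l where l: "l \<le> circ_norm n k (int j - int i) + 1" "(U i, V j) \<in> ?R ^^ l"
        using UV'[OF ij] by blast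
      have "(U i, U j) \<in> ?R ^^ Suc l"
        using l(2) ij by (intro relpow_Suc_I) (auto simp: arc_iff)
      with l(1) m show ?thesis by (intro exI[of _ "Suc l"]) auto
    qed
  next
    fix i j assume xy [simp]: "x = V i" "y = V j"
    have ij: "i < n" "j < n" using assms by (auto simp: verts_GP)
    from assms(3) have "reach n k (int j - int i) m \<or> circ_norm n k (int j - int i) + 2 \<le> m"
      by simp
    then show ?thesis
    proof
      assume "reach n k (int j - int i) m"
      then obtain a where "\<bar>a\<bar> \<le> int m" "int n dvd a * int k - (int j - int i)" by (auto simp: reach_def)
      with relpow_VV[of i j a] ij show ?thesis by (auto intro!: exI[of _ "nat \<bar>a\<bar>"])
    next
      assume m: "circ_norm n k (int j - int i) + 2 \<le> m"
      obtain l where l: "l \<le> circ_norm n k (int j - int i) + 1" "(V i, U j) \<in> ?R ^^ l"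
        using VU'[OF ij] by blast
      have "(V i, V j) \<in> ?R ^^ Suc l"
        using l(2) ij by (intro relpow_Suc_I) (auto simp: arc_iff)
      with l(1) m show ?thesis by (intro exI[of _ "Suc l"]) auto
    qed
  qed
qed

lemma gdist_le_iff_near:
  assumes "x \<in> pverts (GP n k)" "y \<in> pverts (GP n k)"
  shows "gdist (GP n k) x y \<le> ereal (real m) \<longleftrightarrow> near n k x y m"
proof -
  have "gdist (GP n k) x y \<le> ereal (real m) \<longleftrightarrow> (\<exists>l\<le>m. \<exists>p. awalk x p y \<and> length p = l)"
    using gdist_le_iff[OF pair_wf_digraph_axioms, of x y m] by auto
  also have "\<dots> \<longleftrightarrow> (\<exists>l\<le>m. (x, y) \<in> parcs (GP n k) ^^ l)"
    using awalk_length_iff_relpow[OF assms(1)] by simp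
  also have "\<dots> \<longleftrightarrow> near n k x y m"
    using near_imp_relpow[OF assms] relpow_imp_near near_mono by blast
  finally show ?thesis .
qed


section \<open>Finite distances and the sets of closer vertices\<close>

lemma near_eventually: "\<exists>m. near n k x y m"
  by (cases x; cases y) auto

lemma gdist_eq_nat:
  assumes "x \<in> pverts (GP n k)" "y \<in> pverts (GP n k)"
  obtains m where "gdist (GP n k) x y = ereal (real m)"
proof -
  obtain l where "(x, y) \<in> parcs (GP n k) ^^ l"
    using near_eventually[of x y] near_imp_relpow[OF assms] by blast
  then have "x \<rightarrow>\<^sup>*\<^bsub>GP n k\<^esub> y"
    using awalk_length_iff_relpow[OF assms(1)] reachable_awalkI by blast
  then show ?thesis
    using gdist_eq_shortest_path_length that by blast
qed

text \<open>Distances are finite and known through the bounds \<open>near\<close>, so a strict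
  inequality becomes a threshold \<open>m\<close> separating the two.\<close>

lemma mem_closer_iff:
  assumes "x \<in> pverts (GP n k)" "y \<in> pverts (GP n k)"
  shows "w \<in> closer (GP n k) x y \<longleftrightarrow>
    w \<in> pverts (GP n k) \<and> (\<exists>m. near n k w x m \<and> \<not> near n k w y m)"
proof (cases "w \<in> pverts (GP n k)")
  case w: True
  obtain l l' where l: "gdist (GP n k) w x = ereal (real l)" "gdist (GP n k) w y = ereal (real l')"
    using gdist_eq_nat[OF w assms(1)] gdist_eq_nat[OF w assms(2)] by metis
  have "near n k w x m \<longleftrightarrow> l \<le> m" "near n k w y m \<longleftrightarrow> l' \<le> m" for m
    using gdist_le_iff_near[OF w assms(1), of m] gdist_le_iff_near[OF w assms(2), of m]
    by (simp_all add: l)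
  then show ?thesis
    using w by (auto simp: closer_def l intro!: exI[of _ l])
qed (simp add: closer_def)

lemma arc_if_gdist_1:
  assumes "x \<in> pverts (GP n k)" "y \<in> pverts (GP n k)" "gdist (GP n k) x y = ereal (real 1)"
  shows "(x, y) \<in> parcs (GP n k)"
proof -
  have "near n k x y 1" "\<not> near n k x y 0"
    using gdist_le_iff_near[OF assms(1,2), of 1] gdist_le_iff_near[OF assms(1,2), of 0] assms(3)
    by simp_all
  then obtain l where "l \<le> 1" "(x, y) \<in> parcs (GP n k) ^^ l"
    using near_imp_relpow[OF assms(1,2)] by blast
  moreover have "l \<noteq> 0"
    using \<open>\<not> near n k x y 0\<close> calculation near_refl by (metis relpow_0_E)
  ultimately show ?thesis by (cases l) auto
qed

lemma gdist_spoke: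
  assumes "i < n"
  shows "gdist (GP n k) (U i) (V i) = ereal (real 1)"
proof -
  have v: "U i \<in> pverts (GP n k)" "V i \<in> pverts (GP n k)"
    using assms by (auto simp: verts_GP)
  obtain l where l: "gdist (GP n k) (U i) (V i) = ereal (real l)"
    using gdist_eq_nat[OF v] .
  have "circ_norm n k 0 \<le> 0" by (intro circ_norm_le[of 0 0]) auto
  then have "near n k (U i) (V i) 1" "\<not> near n k (U i) (V i) 0" by simp_all
  then have "l \<le> 1" "\<not> l \<le> 0"
    using gdist_le_iff_near[OF v, of 1] gdist_le_iff_near[OF v, of 0] by (simp_all add: l)
  then show ?thesis using l by simp
qed

lemma diameter_ge_1: "ereal (real 1) \<le> graph_diameter (GP n k)"
proof -
  have "0 < n" using k_less by simp
  then have "U 0 \<in> pverts (GP n k)" "V 0 \<in> pverts (GP n k)"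
    by (auto simp: verts_GP)
  then show ?thesis
    unfolding graph_diameter_def using gdist_spoke[OF \<open>0 < n\<close>]
    by (intro SUP_upper2[of "U 0"] SUP_upper2[of "V 0"]) simp_all
qed

section \<open>Reflections of the two rims\<close>

fun reflect :: "int \<Rightarrow> gp_vertex \<Rightarrow> gp_vertex" where
  "reflect s (U i) = U (residue (s - int i))"
| "reflect s (V i) = V (residue (s - int i))"

lemma reflect_in_verts: "reflect s x \<in> pverts (GP n k)"
  by (cases x) (auto simp: verts_GP)

lemma residue_reflect: "i < n \<Longrightarrow> residue (s - int (residue (s - int i))) = i"
  using dvd_residue_diff[of "s - int i"]
  by (intro residue_eqI) (auto simp: algebra_simps)

lemma reflect_reflect: "x \<in> pverts (GP n k) \<Longrightarrow> reflect s (reflect s x) = x"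
  by (auto simp: verts_GP residue_reflect)

text \<open>A reflection negates index differences, and \<open>reach\<close> and
  \<open>circ_norm\<close> are even in them.\<close>

lemma near_reflect: "near n k (reflect s x) (reflect s y) m \<longleftrightarrow> near n k x y m"
proof -
  have "int n dvd (int (residue (s - int j)) - int (residue (s - int i))) - - (int j - int i)" for i j
    using dvd_diff[OF dvd_residue_diff[of "s - int j"] dvd_residue_diff[of "s - int i"]]
    by (simp add: algebra_simps)
  note reach_cong[OF this] circ_norm_cong[OF this]
  then show ?thesis
    by (cases x; cases y) (simp_all only: near.simps reflect.simps reach_uminus circ_norm_uminus)
qed

lemma card_closer_reflect:
  assumes "x \<in> pverts (GP n k)" "y \<in> pverts (GP n k)"
  shows "card (closer (GP n k) (reflect s x) (reflect s y)) = card (closer (GP n k) x y)"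
proof (rule bij_betw_same_card)
  show "bij_betw (reflect s) (closer (GP n k) (reflect s x) (reflect s y)) (closer (GP n k) x y)"
    using assms near_reflect[of s]
    by (intro bij_betw_byWitness[where f' = "reflect s"])
      (auto simp: mem_closer_iff reflect_in_verts reflect_reflect, metis reflect_reflect)
qed

section \<open>Balance as an equation between counts\<close>

text \<open>This is \<open>N s t\<close> of the overview; \<open>t\<close> is the number of rim
  steps allowed beyond the word length.\<close>

definition slack_count :: "nat \<Rightarrow> nat \<Rightarrow> nat" where
  "slack_count s t = card {d \<in> {0..<int n}. reach n s d (circ_norm n k d + t)}"

lemma slack_count_le: "slack_count s t \<le> n"
proof -
  have "slack_count s t \<le> card {0..<int n}" unfolding slack_count_def by (rule card_mono) auto
  then show ?thesis by simp
qed

text \<open>For fixed \<open>j\<close> the difference j - i meets every residue class exactly once,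
  so the count is independent of \<open>j\<close>.\<close>

lemma card_translate:
  "card {i. i < n \<and> reach n s (int j - int i) (circ_norm n k (int j - int i) + t)} = slack_count s t"
  unfolding slack_count_def
proof (rule bij_betw_same_card)
  let ?P = "\<lambda>d. reach n s d (circ_norm n k d + t)"
  have P: "?P d \<longleftrightarrow> ?P d'" if "int n dvd d - d'" for d d'
    using reach_cong[OF that] circ_norm_cong[OF that] by simp
  have 1: "?P (int (residue (int j - int i))) \<longleftrightarrow> ?P (int j - int i)" for i
    by (rule P) simp
  have 2: "?P (int j - int (residue (int j - d))) \<longleftrightarrow> ?P d" for d
  proof (rule P)
    have "int n dvd - (int (residue (int j - d)) - (int j - d))"
      by (simp only: dvd_minus_iff dvd_residue_diff)
    then show "int n dvd int j - int (residue (int j - d)) - d" by (simp add: algebra_simps)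
  qed
  have 3: "int (residue (int j - int (residue (int j - d)))) = d" if "d \<in> {0..<int n}" for d
    using that residue_reflect[of "nat d" "int j"] by auto
  show "bij_betw (\<lambda>i. int (residue (int j - int i))) {i. i < n \<and> ?P (int j - int i)}
      {d \<in> {0..<int n}. ?P d}"
    by (intro bij_betw_byWitness[where f' = "\<lambda>d. residue (int j - d)"])
      (auto simp: 1 2 3 residue_reflect)
qed

lemma card_translate_not:
  "card {i. i < n \<and> \<not> reach n s (int j - int i) (circ_norm n k (int j - int i) + t)} = n - slack_count s t"
proof -
  have "{i. i < n \<and> \<not> reach n s (int j - int i) (circ_norm n k (int j - int i) + t)} =
    {..<n} - {i. i < n \<and> reach n s (int j - int i) (circ_norm n k (int j - int i) + t)}"
    by auto
  then show ?thesis
    by (simp add: card_Diff_subset card_translate subset_eq)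
qed

lemma card_UV:
  "card (U ` {i. i < n \<and> P i} \<union> V ` {i. i < n \<and> Q i}) = card {i. i < n \<and> P i} + card {i. i < n \<and> Q i}"
  by (subst card_Un_disjoint) (auto simp: card_image inj_on_def)

text \<open>Let c be the word length of the difference. The distance to the end of the spoke on the
  other rim is exactly c + 1. So an outer vertex is closer to \<open>U j\<close> iff c outer steps
  suffice, and an inner vertex is closer to \<open>U j\<close> iff c + 1 inner steps do not reach
  \<open>V j\<close>. The two sides thus have sizes N 1 0 + (n - N k 1) and N k 0 + (n - N 1
  1).\<close>

lemma spoke_balanced_iff:
  assumes "j < n"
  shows "card (closer (GP n k) (U j) (V j)) = card (closer (GP n k) (V j) (U j)) \<longleftrightarrow>
    slack_count 1 0 + slack_count 1 1 = slack_count k 0 + slack_count k 1"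
proof -
  let ?f = "\<lambda>i. circ_norm n k (int j - int i)"
  have v: "U j \<in> pverts (GP n k)" "V j \<in> pverts (GP n k)"
    using assms by (auto simp: verts_GP)
  have 1: "(\<exists>m. (r m \<or> c + 2 \<le> m) \<and> \<not> c + 1 \<le> m) \<longleftrightarrow> r c"
    and 2: "(\<exists>m. c + 1 \<le> m \<and> \<not> (r m \<or> c + 2 \<le> m)) \<longleftrightarrow> \<not> r (c + 1)"
    if "\<And>m m'. r m \<Longrightarrow> m \<le> m' \<Longrightarrow> r m'" for r and c :: nat
  proof -
    show "(\<exists>m. (r m \<or> c + 2 \<le> m) \<and> \<not> c + 1 \<le> m) \<longleftrightarrow> r c"
      using that[of _ c] by (auto intro!: exI[of _ c])
    \<comment> \<open>Only the threshold c + 1 can separate: from c + 2 on, the detour over two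
      spokes is available.\<close>
    have "c + 1 \<le> m \<and> \<not> (r m \<or> c + 2 \<le> m) \<longleftrightarrow> m = c + 1 \<and> \<not> r (c + 1)" for m
      by (cases "m = c + 1") auto
    then show "(\<exists>m. c + 1 \<le> m \<and> \<not> (r m \<or> c + 2 \<le> m)) \<longleftrightarrow> \<not> r (c + 1)"
      by simp
  qed
  note 12 = 1[OF reach_mono] 2[OF reach_mono]
  have verts: "U i \<in> pverts (GP n k) \<longleftrightarrow> i < n" "V i \<in> pverts (GP n k) \<longleftrightarrow> i < n" for i
    by (auto simp: verts_GP)
  have "U i \<in> closer (GP n k) (U j) (V j) \<longleftrightarrow> i < n \<and> reach n 1 (int j - int i) (?f i + 0)"
    "V i \<in> closer (GP n k) (U j) (V j) \<longleftrightarrow> i < n \<and> \<not> reach n k (int j - int i) (?f i + 1)"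
    "U i \<in> closer (GP n k) (V j) (U j) \<longleftrightarrow> i < n \<and> \<not> reach n 1 (int j - int i) (?f i + 1)"
    "V i \<in> closer (GP n k) (V j) (U j) \<longleftrightarrow> i < n \<and> reach n k (int j - int i) (?f i + 0)" for i
    by (simp_all only: mem_closer_iff[OF v] mem_closer_iff[OF v(2,1)] near.simps 12 verts add_0_right)
  note mem = this
  have "closer (GP n k) (U j) (V j) =
      U ` {i. i < n \<and> reach n 1 (int j - int i) (?f i + 0)} \<union>
      V ` {i. i < n \<and> \<not> reach n k (int j - int i) (?f i + 1)}" (is "_ = ?S")
  proof (rule set_eqI)
    show "w \<in> closer (GP n k) (U j) (V j) \<longleftrightarrow> w \<in> ?S" for w
      by (cases w) (simp_all only: mem, auto)
  qed
  moreover have "closer (GP n k) (V j) (U j) =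
      U ` {i. i < n \<and> \<not> reach n 1 (int j - int i) (?f i + 1)} \<union>
      V ` {i. i < n \<and> reach n k (int j - int i) (?f i + 0)}" (is "_ = ?S")
  proof (rule set_eqI)
    show "w \<in> closer (GP n k) (V j) (U j) \<longleftrightarrow> w \<in> ?S" for w
      by (cases w) (simp_all only: mem, auto)
  qed
  \<comment> \<open>The bounds by \<open>n\<close> make the truncated subtractions exact.\<close>
  ultimately show ?thesis
    using slack_count_le[of 1 1] slack_count_le[of k 1]
    by (simp only: card_UV card_translate card_translate_not) linarith
qed

lemma distance_balanced_iff:
  "distance_balanced (GP n k) \<longleftrightarrow> slack_count 1 0 + slack_count 1 1 = slack_count k 0 + slack_count k 1"
  (is "_ \<longleftrightarrow> ?B")
proof
  assume "distance_balanced (GP n k)"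
  moreover have "0 < n" using k_less by simp
  moreover have "U 0 \<in> pverts (GP n k)" "V 0 \<in> pverts (GP n k)"
    using \<open>0 < n\<close> by (auto simp: verts_GP)
  ultimately show ?B
    using gdist_spoke spoke_balanced_iff by (auto simp: l_distance_balanced_def)
next
  assume B: ?B
  have "card (closer (GP n k) x y) = card (closer (GP n k) y x)"
    if xy: "x \<in> pverts (GP n k)" "y \<in> pverts (GP n k)" "gdist (GP n k) x y = ereal (real 1)" for x y
  proof -
    have rim: "card (closer (GP n k) x y) = card (closer (GP n k) y x)"
      if "x = C i" "y = C j" "C = U \<or> C = V" for i j C
    proof -
      have "i < n" "j < n" using xy that by (auto simp: verts_GP)
      \<comment> \<open>The reflection with sum i + j swaps the two ends of the rim edge.\<close>
      then have "reflect (int i + int j) x = y" "reflect (int i + int j) y = x"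
        using that by (auto intro!: residue_eqI)
      then show ?thesis using card_closer_reflect[OF xy(1,2)] by metis
    qed
    have "(x, y) \<in> parcs (GP n k)" using xy by (rule arc_if_gdist_1)
    then show ?thesis
      using rim B spoke_balanced_iff by (cases x; cases y) (auto simp: arc_iff)
  qed
  then show "distance_balanced (GP n k)"
    using connected_GP[OF k_pos k_less] diameter_ge_1 by (auto simp: l_distance_balanced_def)
qed

section \<open>Bounding the counts by sets of step numbers\<close>

text \<open>Counted residues are parametrized by a signed number \<open>c\<close> of rim steps. Only
  the residues must be covered by \<open>I\<close>, so \<open>c\<close> may be reduced
  first.\<close>

lemma slack_count_le_card:
  assumes "finite I" "\<And>c. \<bar>c\<bar> \<le> int (circ_norm n k (c * int s) + t) \<Longrightarrow>
      (c * int s) mod int n \<in> (\<lambda>c. (c * int s) mod int n) ` I"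
  shows "slack_count s t \<le> card I"
proof -
  have "{d \<in> {0..<int n}. reach n s d (circ_norm n k d + t)} \<subseteq> (\<lambda>c. (c * int s) mod int n) ` I"
  proof safe
    fix d assume d: "d \<in> {0..<int n}" "reach n s d (circ_norm n k d + t)"
    then obtain c where c: "\<bar>c\<bar> \<le> int (circ_norm n k d + t)" "int n dvd c * int s - d"
      by (auto simp: reach_def)
    have "d = c * int s mod int n" using c(2) d(1) by (simp add: flip: mod_eq_dvd_iff)
    moreover have "\<bar>c\<bar> \<le> int (circ_norm n k (c * int s) + t)"
      using c circ_norm_cong by metis
    ultimately show "d \<in> (\<lambda>c. (c * int s) mod int n) ` I" using assms(2) by blast
  qed
  then show ?thesis
    unfolding slack_count_def using assms(1) surj_card_le by blast
qed

text \<open>Different \<open>c\<close> in the interval give different residues, because the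
  multiples of \<open>s\<close> differ by less than \<open>n\<close>.\<close>

lemma interval_le_slack_count:
  assumes "(u - l) * int s < int n" "1 \<le> s"
    and "\<And>c. l \<le> c \<Longrightarrow> c \<le> u \<Longrightarrow> \<bar>c\<bar> \<le> int (circ_norm n k (c * int s) + t)"
  shows "nat (u - l + 1) \<le> slack_count s t"
proof -
  let ?h = "\<lambda>c. (c * int s) mod int n"
  have "inj_on ?h {l..u}"
  proof (rule inj_onI, rule ccontr)
    fix c c' assume c: "c \<in> {l..u}" "c' \<in> {l..u}" "?h c = ?h c'" "c \<noteq> c'"
    have "int n dvd (c - c') * int s"
      using c(3) by (simp add: mod_eq_dvd_iff algebra_simps)
    moreover have "(c - c') * int s \<noteq> 0" using c(4) assms(2) by simp
    ultimately have "int n \<le> \<bar>(c - c') * int s\<bar>" by (metis dvd_abs_iff zdvd_imp_le zero_less_abs_iff)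
    also have "\<dots> \<le> (u - l) * int s"
      using c(1,2) by (auto simp: abs_mult intro!: mult_right_mono)
    finally show False using assms(1) by simp
  qed
  moreover have "?h ` {l..u} \<subseteq> {d \<in> {0..<int n}. reach n s d (circ_norm n k d + t)}"
  proof safe
    fix c assume c: "c \<in> {l..u}"
    have d: "int n dvd c * int s - ?h c" by (simp add: minus_mod_eq_mult_div)
    show "?h c \<in> {0..<int n}" using k_less by simp
    show "reach n s (?h c) (circ_norm n k (?h c) + t)"
      using assms(3)[of c] c d circ_norm_cong[OF d] by (auto simp: reach_def)
  qed
  moreover have "finite {d \<in> {0..<int n}. reach n s d (circ_norm n k d + t)}"
    by (rule finite_subset[of _ "{0..<int n}"]) auto
  ultimately have "card {l..u} \<le> slack_count s t"
    unfolding slack_count_def by (rule card_inj_on_le)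
  then show ?thesis by simp
qed

section \<open>Counts for the inner rim\<close>

text \<open>No step is longer than \<open>k\<close>, so a shorter word has an integer value of
  absolute value at most k (|b| - 1). It differs from b k, but by at most k (2 |b| - 1) < n, so the
  two are not congruent.\<close>

lemma inner_le_circ_norm:
  assumes "int k * (2 * \<bar>b\<bar> - 1) < int n"
  shows "\<bar>b\<bar> \<le> int (circ_norm n k (b * int k))"
proof (rule ccontr)
  assume "\<not> ?thesis"
  then have less: "int (circ_norm n k (b * int k)) \<le> \<bar>b\<bar> - 1" by simp
  obtain a c where ac: "\<bar>a\<bar> + \<bar>c\<bar> \<le> int (circ_norm n k (b * int k))"
      "int n dvd a + c * int k - b * int k"
    by (rule obtain_circ_norm)
  have "\<bar>a + c * int k\<bar> \<le> \<bar>a\<bar> * int k + \<bar>c\<bar> * int k"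
    using k_pos abs_triangle_ineq[of a "c * int k"] mult_left_mono[of 1 "int k" "\<bar>a\<bar>"]
    by (simp add: abs_mult)
  also have "\<dots> = (\<bar>a\<bar> + \<bar>c\<bar>) * int k" by (simp add: distrib_right)
  also have "\<dots> \<le> (\<bar>b\<bar> - 1) * int k"
    using ac(1) less by (intro mult_right_mono) auto
  finally have le: "\<bar>a + c * int k\<bar> \<le> \<bar>b * int k\<bar> - int k"
    by (simp add: abs_mult algebra_simps)
  then have "a + c * int k - b * int k \<noteq> 0" using k_pos by auto
  then have "int n \<le> \<bar>a + c * int k - b * int k\<bar>"
    using ac(2) by (metis dvd_abs_iff zdvd_imp_le zero_less_abs_iff)
  also have "\<dots> \<le> 2 * \<bar>b * int k\<bar> - int k" using le by linarith
  also have "\<dots> < int n" using assms by (simp add: abs_mult algebra_simps)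
  finally show False by simp
qed

lemma le_slack_count_inner:
  assumes "1 \<le> q" "k * (q - 1) < n"
  shows "q \<le> slack_count k t"
proof -
  \<comment> \<open>These are \<open>q\<close> consecutive integers placed around 0 as evenly as
    possible, which keeps 2 |c| - 1 at most q - 1.\<close>
  define l u where "l = - ((int q - 1) div 2)" and "u = int q div 2"
  have diff: "u - l = int q - 1" unfolding l_def u_def by linarith
  have n: "int k * (int q - 1) < int n"
    using assms by (metis of_nat_1 of_nat_diff of_nat_less_iff of_nat_mult)
  have "\<bar>c\<bar> \<le> int (circ_norm n k (c * int k) + t)" if "l \<le> c" "c \<le> u" for c
  proof -
    have "2 * \<bar>c\<bar> - 1 \<le> int q - 1" using that unfolding l_def u_def by linarith
    then have "int k * (2 * \<bar>c\<bar> - 1) \<le> int k * (int q - 1)" by (intro mult_left_mono) auto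
    with n have "\<bar>c\<bar> \<le> int (circ_norm n k (c * int k))" by (intro inner_le_circ_norm) simp
    then show ?thesis by simp
  qed
  then have "nat (u - l + 1) \<le> slack_count k t"
    using n k_pos by (intro interval_le_slack_count) (simp_all add: diff mult.commute)
  then show ?thesis by (simp add: diff)
qed

text \<open>Here the multiples of \<open>k\<close> form a subgroup of order \<open>q\<close>, and
  all of them are counted, whatever \<open>t\<close> is.\<close>

lemma slack_count_inner_eq:
  assumes "n = k * q"
  shows "slack_count k t = q"
proof (rule antisym)
  have "0 < q" using assms k_less by (cases q) auto
  show "q \<le> slack_count k t" using \<open>0 < q\<close> assms k_pos by (intro le_slack_count_inner) auto
  have "c * int k mod int n \<in> (\<lambda>c. c * int k mod int n) ` {0..<int q}" for c
  proof -
    have "c * int k mod int n = (c mod int q) * int k mod int n"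
      by (simp add: assms mult.commute[of "int k"] flip: mult_mod_left)
    then show ?thesis using \<open>0 < q\<close> by (auto intro!: image_eqI[of _ _ "c mod int q"])
  qed
  then show "slack_count k t \<le> q" using slack_count_le_card[of "{0..<int q}" k t] by simp
qed

section \<open>Counts for the outer rim\<close>

text \<open>Take \<open>r\<close> steps of size \<open>k\<close> and correct the remaining error by
  steps of size 1.\<close>

lemma circ_norm_le_inner_steps:
  "int (circ_norm n k c) \<le> int r + \<bar>\<bar>c\<bar> - int r * int k\<bar>"
proof -
  have "circ_norm n k \<bar>c\<bar> \<le> nat (int r + \<bar>\<bar>c\<bar> - int r * int k\<bar>)"
    by (intro circ_norm_le[of "\<bar>c\<bar> - int r * int k" "int r"]) auto
  then show ?thesis by (cases "c \<ge> 0") auto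
qed

lemma slack_count_outer_le:
  assumes "\<And>c. \<bar>c\<bar> \<le> int (circ_norm n k c + t) \<Longrightarrow> \<bar>c\<bar> \<le> int B"
  shows "slack_count 1 t \<le> 2 * B + 1"
  using slack_count_le_card[of "{- int B..int B}" 1 t] assms by (force simp: abs_le_iff)

lemma le_slack_count_outer:
  assumes "\<And>c. \<bar>c\<bar> \<le> int B \<Longrightarrow> \<bar>c\<bar> \<le> int (circ_norm n k c + t)" "2 * B < n"
  shows "2 * B + 1 \<le> slack_count 1 t"
  using interval_le_slack_count[of "int B" "- int B" 1 t] assms by (force simp: abs_le_iff)

text \<open>With one step of size \<open>k\<close>, |c| is at most 1 + ||c| - k|. This excludes |c|
  \<ge> k and otherwise gives 2 |c| \<le> k + 1.\<close>

lemma slack_count_outer_0_le: "2 \<le> k \<Longrightarrow> slack_count 1 0 \<le> 2 * ((k + 1) div 2) + 1"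
proof (rule slack_count_outer_le)
  fix c assume "2 \<le> k" "\<bar>c\<bar> \<le> int (circ_norm n k c + 0)"
  then show "\<bar>c\<bar> \<le> int ((k + 1) div 2)" using circ_norm_le_inner_steps[of c 1] by linarith
qed

lemma slack_count_outer_1_le: "3 \<le> k \<Longrightarrow> slack_count 1 1 \<le> 2 * ((k + 2) div 2) + 1"
proof (rule slack_count_outer_le)
  fix c assume "3 \<le> k" "\<bar>c\<bar> \<le> int (circ_norm n k c + 1)"
  then show "\<bar>c\<bar> \<le> int ((k + 2) div 2)" using circ_norm_le_inner_steps[of c 1] by linarith
qed

text \<open>For \<open>k = 2\<close> and slack 1, a single step of size 2 saves too little to
  exclude large |c|; two such steps exclude |c| \<ge> 4.\<close>

lemma slack_count_outer_1_le_7: "k = 2 \<Longrightarrow> slack_count 1 1 \<le> 7"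
proof -
  assume "k = 2"
  have "slack_count 1 1 \<le> 2 * 3 + 1"
  proof (rule slack_count_outer_le)
    fix c assume "\<bar>c\<bar> \<le> int (circ_norm n k c + 1)"
    then show "\<bar>c\<bar> \<le> int 3" using circ_norm_le_inner_steps[of c 2] \<open>k = 2\<close> by simp
  qed
  then show ?thesis by simp
qed

text \<open>A word \<open>a\<close>, \<open>e\<close> that is too short agrees with \<open>c\<close>
  even as an integer, by the size of \<open>n\<close>. If \<open>e\<close> is 0, then |a| = |c|;
  otherwise k \<le> |a| + |c|, while shortness with |e| \<ge> 1 forces |a| + |c| \<le> k -
  1.\<close>

lemma outer_le_circ_norm:
  assumes "2 \<le> k" "k * (k + 2) \<le> n" "t \<le> 1" "2 * \<bar>c\<bar> \<le> int k + 1 + int t"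
  shows "\<bar>c\<bar> \<le> int (circ_norm n k c + t)"
proof (rule ccontr)
  assume "\<not> ?thesis"
  then have less: "int (circ_norm n k c) + int t + 1 \<le> \<bar>c\<bar>" by simp
  obtain a e where ae: "\<bar>a\<bar> + \<bar>e\<bar> \<le> int (circ_norm n k c)" "int n dvd a + e * int k - c"
    by (rule obtain_circ_norm)
  \<comment> \<open>Crude bounds, chosen so that their total stays below k k + 2 k.\<close>
  have e: "\<bar>e\<bar> \<le> int k" and small: "\<bar>a\<bar> + \<bar>c\<bar> < 2 * int k"
    using assms ae(1) less by linarith+
  have "\<bar>a + e * int k - c\<bar> \<le> \<bar>a\<bar> + \<bar>e * int k\<bar> + \<bar>c\<bar>" by linarith
  also have "\<dots> < int k * int k + 2 * int k"
    using small mult_right_mono[OF e, of "int k"] by (simp add: abs_mult)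
  also have "\<dots> \<le> int n"
    using assms(2) by (metis add_mult_distrib2 mult.commute of_nat_add of_nat_le_iff of_nat_mult of_nat_numeral)
  finally have "a + e * int k - c = 0"
    using dvd_imp_le_int[OF _ ae(2)] by fastforce
  then have eq: "e * int k = c - a" by simp
  show False
  proof (cases "e = 0")
    case True
    then show ?thesis using eq ae(1) less by simp
  next
    case False
    then have "int k \<le> \<bar>e * int k\<bar>" using mult_right_mono[of 1 "\<bar>e\<bar>" "int k"] by (simp add: abs_mult)
    then show ?thesis using eq ae(1) less assms(4) False by linarith
  qed
qed

lemma le_slack_count_outer_div:
  assumes "2 \<le> k" "k * (k + 2) \<le> n" "t \<le> 1"
  shows "2 * ((k + 1 + t) div 2) + 1 \<le> slack_count 1 t"
proof (rule le_slack_count_outer)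
  show "2 * ((k + 1 + t) div 2) < n"
    using assms mult_right_mono[of 2 k "k + 2"] by simp
  fix c assume "\<bar>c\<bar> \<le> int ((k + 1 + t) div 2)"
  then show "\<bar>c\<bar> \<le> int (circ_norm n k c + t)" by (intro outer_le_circ_norm assms) linarith
qed

section \<open>Comparison of the two sides\<close>

text \<open>With q = k + 3 the inner counts add up to at least 2 k + 6, the outer ones to at most 2
  k + 4.\<close>

lemma not_distance_balanced_GP:
  assumes "3 \<le> k" "k * (k + 2) < n"
  shows "\<not> distance_balanced (GP n k)"
proof -
  have "k + 3 \<le> slack_count k t" for t using assms by (intro le_slack_count_inner) auto
  from this[of 0] this[of 1] show ?thesis
    using slack_count_outer_0_le slack_count_outer_1_le assms(1) unfolding distance_balanced_iff by linarith
qed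

lemma distance_balanced_GP:
  assumes "3 \<le> k" "n = k * (k + 2)"
  shows "distance_balanced (GP n k)"
proof -
  have "2 * ((k + 1) div 2) + 1 \<le> slack_count 1 0" "2 * ((k + 2) div 2) + 1 \<le> slack_count 1 1"
    using le_slack_count_outer_div[of 0] le_slack_count_outer_div[of 1] assms by simp_all
  \<comment> \<open>Exactly one of the two halves is rounded down. The outer sum is therefore 2 k +
    4, as is the inner one with q = k + 2.\<close>
  moreover have "(k + 1) div 2 + (k + 2) div 2 = k + 1" by presburger
  ultimately show ?thesis
    using slack_count_inner_eq[OF assms(2), of 0] slack_count_inner_eq[OF assms(2), of 1]
      slack_count_outer_0_le slack_count_outer_1_le assms(1)
    unfolding distance_balanced_iff by linarith
qed

text \<open>The choice q = 6 requires exactly 2 * 5 < n; the inner counts then give at least 12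
  against at most 3 + 7.\<close>

lemma not_distance_balanced_GP_2:
  assumes "k = 2" "10 < n"
  shows "\<not> distance_balanced (GP n k)"
proof -
  have "6 \<le> slack_count k t" for t using assms by (intro le_slack_count_inner) auto
  from this[of 0] this[of 1] show ?thesis
    using slack_count_outer_0_le slack_count_outer_1_le_7 assms(1) unfolding distance_balanced_iff by simp
qed

lemma distance_balanced_GP_2:
  assumes "k = 2" "n = 10"
  shows "distance_balanced (GP n k)"
proof -
  have "2 * 3 + 1 \<le> slack_count 1 1"
  \<comment> \<open>Here \<open>outer_le_circ_norm\<close> covers only |c| \<le> 2, so the range up
    to 3 is checked directly.\<close>
  proof (rule le_slack_count_outer)
    fix c assume c: "\<bar>c\<bar> \<le> int 3"
    obtain a e where "\<bar>a\<bar> + \<bar>e\<bar> \<le> int (circ_norm n k c)" "int n dvd a + e * int k - c"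
      by (rule obtain_circ_norm)
    then show "\<bar>c\<bar> \<le> int (circ_norm n k c + 1)"
      using c assms by simp presburger
  qed (simp add: assms)
  moreover have "3 \<le> slack_count 1 0" using le_slack_count_outer_div[of 0] assms by simp
  moreover have "slack_count k t = 5" for t using slack_count_inner_eq[of 5] assms by simp
  ultimately show ?thesis
    using slack_count_outer_0_le slack_count_outer_1_le_7 assms(1) unfolding distance_balanced_iff by simp
qed

end

theorem theorem1p4:
  fixes n k :: nat
  assumes "2 \<le> k" and "real k < real n / 2"
  shows "((k \<ge> 3 \<and> n > k * (k + 2) \<longrightarrow> \<not> distance_balanced (GP n k)) \<and>
          (k \<ge> 3 \<longrightarrow> distance_balanced (GP (k * (k + 2)) k))) \<and>
         ((k = 2 \<and> n > 10 \<longrightarrow> \<not> distance_balanced (GP n 2)) \<and>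
          distance_balanced (GP 10 2))"
proof -
  interpret G: generalized_petersen n k using assms by unfold_locales linarith+
  interpret D: generalized_petersen 10 2 by unfold_locales simp_all
  have "distance_balanced (GP (k * (k + 2)) k)" if "3 \<le> k"
  proof -
    interpret B: generalized_petersen "k * (k + 2)" k
      using that by unfold_locales (auto simp: mult.commute)
    show ?thesis using that by (rule B.distance_balanced_GP) simp
  qed
  then show ?thesis
    using G.not_distance_balanced_GP G.not_distance_balanced_GP_2 D.distance_balanced_GP_2 by simp
qed

end
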